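(* Let $N\ge 1$ be an integer and $c>0$. The operators $L^{\mathrm{IRW}}$ and $L^{\mathrm{DIF}}$ are in duality, with duality function $$D(n,x)=\prod_{j=1}^N H(n_j,x_j;c),\qquad n\in\mathbb N^N,\ x\in\mathbb R^N,$$ i.e. $[L^{\mathrm{IRW}}D(\cdot,x)](n)=[L^{\mathrm{DIF}}D(n,\cdot)](x)$ for all $n\in\mathbb N^N$, $x\in\mathbb R^N$.
   Context: $\mathbb N$ is the set of nonnegative integers. For $f:\mathbb N^N\to\mathbb C$, $$L^{\mathrm{IRW}}f(n)=\sum_{1\le i<j\le N}\Big[n_i\big(f(n^{i,j})-f(n)\big)+n_j\big(f(n^{j,i})-f(n)\big)\Big],$$ where $n^{i,j}=n-e_i+e_j$ with $e_i$ the $i$-th standard basis vector (a term with prefactor $n_i=0$ is zero). For smooth functions $f$ on $\mathbb R^N$, $$L^{\mathrm{DIF}}f(x)=\sum_{1\le i<j\le N}\left[c\left(\frac{\partial}{\partial x_i}-\frac{\partial}{\partial x_j}\right)^2f(x)-(x_i-x_j)\left(\frac{\partial}{\partial x_i}-\frac{\partial}{\partial x_j}\right)f(x)\right].$$ The Hermite polynomials are $H_n(x)=n!\sum_{m=0}^{\lfloor n/2\rfloor}\frac{(-1)^m(2x)^{n-2m}}{m!\,(n-2m)!}$, and $$H(n,x;c)=e^{c/2}(2c)^{-n/2}H_n\!\left(\tfrac{x}{\sqrt{2c}}\right).$$ *)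

theory Defs
  imports "HOL-Analysis.Analysis"
begin

text \<open>The index set \<open>{1, \<dots>, N}\<close> is a type of class \<open>{finite, linorder}\<close>, with \<open>N = CARD('N)\<close>
  arbitrary and at least 1; \<open>\<nat>\<^sup>N\<close> is \<open>nat ^ 'N\<close> and \<open>\<real>\<^sup>N\<close> is \<open>real ^ 'N\<close>.\<close>

text \<open>The subtraction on \<open>nat\<close> truncates when \<open>n\<^sub>i = 0\<close>, but \<open>hop n i j\<close> is then used only with
  the prefactor \<open>n\<^sub>i = 0\<close>.\<close>

definition hop :: "nat ^ 'N \<Rightarrow> 'N \<Rightarrow> 'N \<Rightarrow> nat ^ 'N"
  where "hop n i j = n - axis i 1 + axis j 1"

definition L_IRW :: "(nat ^ 'N::{finite,linorder} \<Rightarrow> complex) \<Rightarrow> nat ^ 'N::{finite,linorder} \<Rightarrow> complex"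
  where "L_IRW f n = (\<Sum>(i, j) \<in> {(i, j). i < j}.
           of_nat (n $ i) * (f (hop n i j) - f n) + of_nat (n $ j) * (f (hop n j i) - f n))"

definition partial_deriv :: "'N \<Rightarrow> (real ^ 'N \<Rightarrow> complex) \<Rightarrow> real ^ 'N \<Rightarrow> complex"
  where "partial_deriv i f x = vector_derivative (\<lambda>t. f (x + t *\<^sub>R axis i 1)) (at 0)"

primrec C_k :: "nat \<Rightarrow> (real ^ 'N \<Rightarrow> complex) \<Rightarrow> bool"
  where
    "C_k 0 f \<longleftrightarrow> continuous_on UNIV f"
  | "C_k (Suc k) f \<longleftrightarrow> (\<forall>x. f differentiable at x) \<and> (\<forall>i. C_k k (partial_deriv i f))"

definition smooth :: "(real ^ 'N \<Rightarrow> complex) \<Rightarrow> bool"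
  where "smooth f \<longleftrightarrow> (\<forall>k. C_k k f)"

definition deriv_diff :: "'N \<Rightarrow> 'N \<Rightarrow> (real ^ 'N \<Rightarrow> complex) \<Rightarrow> real ^ 'N \<Rightarrow> complex"
  where "deriv_diff i j f x = partial_deriv i f x - partial_deriv j f x"

text \<open>Being built from \<^const>\<open>vector_derivative\<close>, \<open>L_DIF c f\<close> is meaningful only if \<open>f\<close> is smooth.\<close>

definition L_DIF ::
    "real \<Rightarrow> (real ^ 'N::{finite,linorder} \<Rightarrow> complex) \<Rightarrow> real ^ 'N::{finite,linorder} \<Rightarrow> complex"
  where "L_DIF c f x = (\<Sum>(i, j) \<in> {(i, j). i < j}.
           of_real c * deriv_diff i j (deriv_diff i j f) x
           - of_real (x $ i - x $ j) * deriv_diff i j f x)"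

definition Hermite :: "nat \<Rightarrow> real \<Rightarrow> real"
  where "Hermite n x =
           fact n * (\<Sum>m = 0..n div 2. (-1) ^ m * (2 * x) ^ (n - 2 * m) / (fact m * fact (n - 2 * m)))"

definition H :: "nat \<Rightarrow> real \<Rightarrow> real \<Rightarrow> real"
  where "H n x c = exp (c / 2) * (2 * c) powr (- real n / 2) * Hermite n (x / sqrt (2 * c))"

definition D :: "real \<Rightarrow> nat ^ 'N \<Rightarrow> real ^ 'N \<Rightarrow> complex"
  where "D c n x = of_real (\<Prod>j\<in>UNIV. H (n $ j) (x $ j) c)"

definition in_duality ::
    "(('a \<Rightarrow> 'c) \<Rightarrow> 'a \<Rightarrow> 'c) \<Rightarrow> (('b \<Rightarrow> 'c) \<Rightarrow> 'b \<Rightarrow> 'c) \<Rightarrow> ('a \<Rightarrow> 'b \<Rightarrow> 'c) \<Rightarrow> bool"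
  where "in_duality L1 L2 F \<longleftrightarrow> (\<forall>n x. L1 (\<lambda>m. F m x) n = L2 (\<lambda>y. F n y) x)"

end

theory Submission
  imports Defs
begin

text \<open>The functions \<open>h\<^sub>n = H(n, \<cdot>; c)\<close> satisfy \<open>h\<^sub>n' = (n / c) h\<^sub>n\<^sub>-\<^sub>1\<close> and
  \<open>h\<^sub>n\<^sub>+\<^sub>1 = (x / c) h\<^sub>n - (n / c) h\<^sub>n\<^sub>-\<^sub>1\<close>, hence also \<open>c h\<^sub>n'' - x h\<^sub>n' = - n h\<^sub>n\<close>. In the term
  of \<open>L\<^sup>D\<^sup>I\<^sup>F\<close> for \<open>i < j\<close>, the pure parts \<open>c \<partial>\<^sub>i\<^sup>2 - x\<^sub>i \<partial>\<^sub>i\<close> and \<open>c \<partial>\<^sub>j\<^sup>2 - x\<^sub>j \<partial>\<^sub>j\<close> therefore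
  contribute \<open>-(n\<^sub>i + n\<^sub>j) D\<close>, while the cross part
  \<open>-2c \<partial>\<^sub>i \<partial>\<^sub>j + x\<^sub>j \<partial>\<^sub>i + x\<^sub>i \<partial>\<^sub>j\<close> creates a particle at one site and removes one at the other.\<close>

section \<open>Recurrence and derivative of the Hermite polynomials\<close>

definition Hermite_term :: "nat \<Rightarrow> real \<Rightarrow> nat \<Rightarrow> real"
  where "Hermite_term n x m =
    (if 2 * m \<le> n then (-1) ^ m * (2 * x) ^ (n - 2 * m) / (fact m * fact (n - 2 * m)) else 0)"

text \<open>Since \<open>Hermite_term\<close> is extended by zero past \<open>n div 2\<close>, sums
  of different degrees can share an upper limit and be compared term by term.\<close>

lemma Hermite_eq_sum_terms:
  assumes "n div 2 \<le> M"
  shows "Hermite n x = fact n * (\<Sum>m\<le>M. Hermite_term n x m)"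
proof -
  have "(\<Sum>m\<le>M. Hermite_term n x m) = (\<Sum>m = 0..n div 2. Hermite_term n x m)"
    using assms by (intro sum.mono_neutral_right) (auto simp: Hermite_term_def)
  also have "\<dots> = (\<Sum>m = 0..n div 2. (-1) ^ m * (2 * x) ^ (n - 2 * m) / (fact m * fact (n - 2 * m)))"
    by (intro sum.cong) (auto simp: Hermite_term_def)
  finally show ?thesis
    by (simp add: Hermite_def)
qed

text \<open>In the generic case all three terms are multiples of one monomial \<open>p\<close>, and
  the claim reduces to the splitting \<open>n + 2 = (k + 1) + 2 * (m + 1)\<close> of the
  degree.\<close>

lemma Hermite_term_rec:
  "real (Suc (Suc n)) * Hermite_term (Suc (Suc n)) x (Suc m) =
     2 * x * Hermite_term (Suc n) x (Suc m) - 2 * Hermite_term n x m"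
proof (cases "2 * Suc m \<le> Suc n")
  case True
  then have "Suc (2 * m) \<le> n" by simp
  then obtain k where n: "n = Suc (2 * m + k)"
    using le_Suc_ex[of "Suc (2 * m)" n] by auto
  define p where "p = (-1) ^ m * (2 * x) ^ Suc k / (fact m * fact (Suc k))"
  have "Hermite_term n x m = p"
    by (simp add: n Hermite_term_def p_def)
  moreover have "Hermite_term (Suc (Suc n)) x (Suc m) = - p / real (Suc m)"
    by (simp add: n Hermite_term_def p_def)
  moreover have "2 * x * Hermite_term (Suc n) x (Suc m) = - real (Suc k) * p / real (Suc m)"
    by (simp add: n Hermite_term_def p_def mult_ac del: of_nat_Suc)
  moreover have "real (Suc (Suc n)) = real (Suc k) + 2 * real (Suc m)"
    by (simp add: n)
  moreover have "(K + 2 * M) * (- p / M) = - K * p / M - 2 * p" if "M \<noteq> 0" for K M :: real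
    using that by (simp add: field_simps)
  ultimately show ?thesis
    by (simp only: of_nat_eq_0_iff nat.simps not_False_eq_True)
next
  case False
  \<comment> \<open>Boundary case: for \<open>n = 2 * m\<close> only the middle term vanishes; for
    \<open>n < 2 * m\<close> all three do.\<close>
  then have "n = 2 * m \<or> n < 2 * m" by auto
  then show ?thesis
    by (elim disjE) (simp_all add: Hermite_term_def divide_simps)
qed

lemma Hermite_term_rec_0:
  "real (Suc n) * Hermite_term (Suc n) x 0 = 2 * x * Hermite_term n x 0"
  by (simp add: Hermite_term_def divide_simps)

lemma Hermite_Suc:
  "Hermite (Suc n) x = 2 * x * Hermite n x - 2 * real n * Hermite (n - 1) x"
proof (cases n)
  case 0
  then show ?thesis by (simp add: Hermite_def)
next
  case (Suc k)
  let ?S = "\<lambda>n M. \<Sum>m\<le>M. Hermite_term n x m"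
  \<comment> \<open>The factor \<open>real (Suc n)\<close> is what \<open>fact (Suc n)\<close> adds
    to \<open>fact n\<close>. The term at 0 is split off because the recurrence pairs
    \<open>Suc m\<close> with \<open>m\<close>.\<close>
  have "real (Suc n) * ?S (Suc n) (Suc n) =
      real (Suc n) * Hermite_term (Suc n) x 0 +
      (\<Sum>m\<le>n. real (Suc n) * Hermite_term (Suc n) x (Suc m))"
    by (simp only: sum.atMost_Suc_shift sum_distrib_left distrib_left)
  also have "\<dots> = 2 * x * Hermite_term n x 0 +
      (\<Sum>m\<le>n. 2 * x * Hermite_term n x (Suc m) - 2 * Hermite_term k x m)"
    by (simp only: Suc Hermite_term_rec Hermite_term_rec_0)
  also have "\<dots> = 2 * x * ?S n (Suc n) - 2 * ?S k n"
    by (simp only: sum.atMost_Suc_shift sum_distrib_left distrib_left sum_subtractf)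
  finally have *: "real (Suc n) * ?S (Suc n) (Suc n) = 2 * x * ?S n (Suc n) - 2 * ?S k n" .
  have terms: "Hermite n x = fact n * ?S n (Suc n)" "Hermite k x = fact k * ?S k n"
    by (rule Hermite_eq_sum_terms; simp add: Suc)+
  have "Hermite (Suc n) x = fact n * (real (Suc n) * ?S (Suc n) (Suc n))"
    by (simp add: Hermite_eq_sum_terms[of "Suc n" "Suc n"] algebra_simps)
  also have "\<dots> = 2 * x * (fact n * ?S n (Suc n)) - 2 * real n * (fact k * ?S k n)"
    unfolding * by (simp add: Suc algebra_simps)
  also have "\<dots> = 2 * x * Hermite n x - 2 * real n * Hermite k x"
    by (simp only: terms)
  finally show ?thesis using Suc by simp
qed

lemma DERIV_Hermite_term:
  "((\<lambda>x. Hermite_term (Suc n) x m) has_real_derivative 2 * Hermite_term n x m) (at x)"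
proof (cases "2 * m \<le> n")
  case True
  then obtain k where n: "n = 2 * m + k"
    using le_Suc_ex by blast
  have "((\<lambda>x. (2 * x) ^ Suc k) has_real_derivative real (Suc k) * (2 * x) ^ k * 2) (at x)"
    using DERIV_power_Suc[OF DERIV_cmult_Id[of 2], of k x] by (simp add: mult_ac)
  then have "((\<lambda>x. (-1) ^ m / (fact m * fact (Suc k)) * (2 * x) ^ Suc k) has_real_derivative
      (-1) ^ m / (fact m * fact (Suc k)) * (real (Suc k) * (2 * x) ^ k * 2)) (at x)"
    by (rule DERIV_cmult)
  moreover have "(-1) ^ m / (fact m * fact (Suc k)) * (real (Suc k) * (2 * x) ^ k * 2) =
      2 * Hermite_term n x m"
    by (simp add: n Hermite_term_def del: of_nat_Suc)
  moreover have "Hermite_term (Suc n) y m = (-1) ^ m / (fact m * fact (Suc k)) * (2 * y) ^ Suc k" for y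
    by (simp add: n Hermite_term_def Suc_diff_le)
  ultimately show ?thesis by simp
next
  case False
  \<comment> \<open>The truncated exponent is 0, so the term is constant in \<open>x\<close>: its
    value is zero unless \<open>2 * m = Suc n\<close>.\<close>
  then have "Suc n - 2 * m = 0" by simp
  then have "(\<lambda>y. Hermite_term (Suc n) y m) = (\<lambda>_. Hermite_term (Suc n) 0 m)"
    by (simp only: Hermite_term_def power_0)
  with False show ?thesis
    by (simp add: Hermite_term_def[of n])
qed

lemma DERIV_Hermite:
  "(Hermite n has_real_derivative 2 * real n * Hermite (n - 1) x) (at x)"
proof (cases n)
  case 0
  then have "Hermite n = (\<lambda>_. 1)" by (simp add: Hermite_def fun_eq_iff)
  with 0 show ?thesis by simp
next
  case (Suc k)
  have "Hermite n = (\<lambda>x. fact n * (\<Sum>m\<le>n. Hermite_term (Suc k) x m))"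
    unfolding Suc by (intro ext Hermite_eq_sum_terms) simp
  moreover have "((\<lambda>x. fact n * (\<Sum>m\<le>n. Hermite_term (Suc k) x m)) has_real_derivative
      fact n * (\<Sum>m\<le>n. 2 * Hermite_term k x m)) (at x)"
    by (intro DERIV_cmult DERIV_sum DERIV_Hermite_term)
  moreover have "fact n * (\<Sum>m\<le>n. 2 * Hermite_term k x m) = 2 * real n * Hermite k x"
  proof -
    have "Hermite k x = fact k * (\<Sum>m\<le>n. Hermite_term k x m)"
      by (rule Hermite_eq_sum_terms) (simp add: Suc)
    moreover have "fact n = real n * fact k"
      by (simp add: Suc)
    ultimately show ?thesis
      by (simp only: sum_distrib_left[symmetric] mult_ac)
  qed
  ultimately show ?thesis using Suc by simp
qed

section \<open>The rescaled one-site functions \<open>H\<close>\<close>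

lemma powr_half_Suc:
  assumes "b > (0::real)"
  shows "b powr (- real (Suc n) / 2) = b powr (- real n / 2) / sqrt b"
proof -
  have "- real (Suc n) / 2 = - real n / 2 - 1 / 2" by (simp add: field_simps)
  then show ?thesis
    using assms by (simp only: powr_diff) (simp add: powr_half_sqrt)
qed

text \<open>Hides the real power and the root: with \<open>s = sqrt (2 * c)\<close>, the relations
  for \<open>s\<close> and \<open>w\<close> turn later claims into rational identities.\<close>

lemma H_scaling:
  assumes "c > 0"
  obtains s w where "s > 0" "c = s * s / 2" "\<And>n. w (Suc n) = w n / s"
    "\<And>n x. H n x c = w n * Hermite n (x / s)"
proof (rule that)
  show "sqrt (2 * c) > 0" "c = sqrt (2 * c) * sqrt (2 * c) / 2" using assms by simp_all
  show "exp (c / 2) * (2 * c) powr (- real (Suc n) / 2) =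
      exp (c / 2) * (2 * c) powr (- real n / 2) / sqrt (2 * c)" for n
    using assms powr_half_Suc[of "2 * c" n] by simp
qed (simp add: H_def)

lemma H_Suc:
  assumes "c > 0"
  shows "H (Suc n) x c = x / c * H n x c - real n / c * H (n - 1) x c"
proof -
  obtain s w where "s > 0" and c: "c = s * s / 2" and w: "\<And>n. w (Suc n) = w n / s"
    and H: "\<And>n x. H n x c = w n * Hermite n (x / s)"
    using H_scaling[OF assms] by blast
  show ?thesis
    unfolding H unfolding c Hermite_Suc using \<open>s > 0\<close>
    by (cases n) (simp_all add: w field_simps)
qed

lemma DERIV_H:
  assumes "c > 0"
  shows "((\<lambda>x. H n x c) has_real_derivative real n / c * H (n - 1) x c) (at x)"
proof -
  obtain s w where "s > 0" and c: "c = s * s / 2" and w: "\<And>n. w (Suc n) = w n / s"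
    and H: "\<And>n x. H n x c = w n * Hermite n (x / s)"
    using H_scaling[OF assms] by blast
  have "((\<lambda>x. x / s) has_real_derivative 1 / s) (at x)"
    by (intro DERIV_cdivide DERIV_ident)
  then have "((\<lambda>x. w n * Hermite n (x / s)) has_real_derivative
      w n * (2 * real n * Hermite (n - 1) (x / s) * (1 / s))) (at x)"
    by (intro DERIV_cmult DERIV_chain2[OF DERIV_Hermite])
  moreover have "w n * (2 * real n * Hermite (n - 1) (x / s) * (1 / s)) = real n / c * H (n - 1) x c"
    unfolding H unfolding c using \<open>s > 0\<close> by (cases n) (simp_all add: w field_simps)
  ultimately show ?thesis
    by (simp only: H)
qed

text \<open>The two-site identity with every derivative already replaced by its value from
  \<open>DERIV_H\<close>, so that only algebra remains.\<close>

lemma H_pair_duality: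
  assumes "c > 0"
  shows "c * (real a / c * (real (a - 1) / c * H (a - 2) x c) * H b y c
           - 2 * (real a / c * H (a - 1) x c * (real b / c * H (b - 1) y c))
           + H a x c * (real b / c * (real (b - 1) / c * H (b - 2) y c)))
         - (x - y) * (real a / c * H (a - 1) x c * H b y c - H a x c * (real b / c * H (b - 1) y c))
       = real a * (H (a - 1) x c * H (b + 1) y c - H a x c * H b y c)
         + real b * (H (a + 1) x c * H (b - 1) y c - H a x c * H b y c)"
proof -
  \<comment> \<open>The Hermite equation \<open>n h = z h' - c h''\<close>, obtained by multiplying
    the recurrence by \<open>n\<close>; this factor makes the case \<open>n = 0\<close>
    trivial.\<close>
  have ode: "real n * H n z c = z / c * (real n * H (n - 1) z c)
      - real n * (real (n - 1) / c * H (n - 2) z c)" for n z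
    by (cases n) (simp_all add: H_Suc[OF assms] algebra_simps add_divide_distrib numeral_2_eq_2)
  have "real a * (real (a - 1) / c * H (a - 2) x c) = x / c * (real a * H (a - 1) x c) - real a * H a x c"
       "real b * (real (b - 1) / c * H (b - 2) y c) = y / c * (real b * H (b - 1) y c) - real b * H b y c"
    using ode[of a x] ode[of b y] by simp_all
  moreover have "H (a + 1) x c = x / c * H a x c - real a / c * H (a - 1) x c"
    "H (b + 1) y c = y / c * H b y c - real b / c * H (b - 1) y c"
    using H_Suc[OF assms] by simp_all
  moreover have "c * (real a / c * P * Q - 2 * R + S * (real b / c * T)) =
      (real a * P) * Q - 2 * c * R + S * (real b * T)" for P Q R S T
    using assms by (simp add: field_simps)
  \<comment> \<open>Here \<open>d\<close> stands for \<open>inverse c\<close>, making the claim a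
    polynomial identity modulo \<open>c * d = 1\<close>.\<close>
  moreover have "(x * d * (a * A1) - a * A) * B - 2 * c * (a * d * A1 * (b * d * B1))
      + A * (y * d * (b * B1) - b * B) - (x - y) * (a * d * A1 * B - A * (b * d * B1))
    = a * (A1 * (y * d * B - b * d * B1) - A * B) + b * ((x * d * A - a * d * A1) * B1 - A * B)"
    if "c * d = 1" for a b d A A1 B B1 :: real
    using that by algebra
  moreover have "c * inverse c = 1"
    using assms by simp
  ultimately show ?thesis
    by (simp only: divide_inverse)
qed

section \<open>Derivatives and smoothness of the duality function\<close>

lemma D_remove:
  "D c n x = of_real ((\<Prod>k\<in>UNIV - {i}. H (n $ k) (x $ k) c) * H (n $ i) (x $ i) c)"
  unfolding D_def prod.remove[OF finite_class.finite_UNIV UNIV_I[of i]] by (simp only: mult.commute)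

text \<open>Only the factor at site \<open>i\<close> depends on \<open>t\<close>. If
  \<open>n $ i = 0\<close>, the truncated index is harmless because the coefficient
  vanishes.\<close>

lemma has_vector_derivative_D:
  fixes n :: "nat ^ 'N::finite"
  assumes "c > 0"
  shows "((\<lambda>t. D c n (x + t *\<^sub>R axis i 1)) has_vector_derivative
           of_real (real (n $ i) / c) * D c (n - axis i 1) x) (at 0)"
proof -
  let ?R = "\<Prod>k\<in>UNIV - {i}. H (n $ k) (x $ k) c"
  have "D c n (x + t *\<^sub>R axis i 1) = of_real (?R * H (n $ i) (x $ i + t) c)" for t
    unfolding D_remove[of c n _ i] by (simp add: axis_def)
  moreover have "((\<lambda>t. ?R * H (n $ i) (x $ i + t) c) has_real_derivative
      ?R * (real (n $ i) / c * H (n $ i - 1) (x $ i) c)) (at 0)"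
    using DERIV_H[OF assms, of "n $ i" "x $ i"]
      DERIV_shift[of "\<lambda>y. H (n $ i) y c" _ 0 "x $ i"]
    by (intro DERIV_cmult) (simp add: add.commute)
  then have "((\<lambda>t. complex_of_real (?R * H (n $ i) (x $ i + t) c)) has_vector_derivative
      of_real (?R * (real (n $ i) / c * H (n $ i - 1) (x $ i) c))) (at 0)"
    by (intro has_vector_derivative_of_real)
       (simp add: has_real_derivative_iff_has_vector_derivative)
  moreover have "of_real (?R * (real (n $ i) / c * H (n $ i - 1) (x $ i) c)) =
      of_real (real (n $ i) / c) * D c (n - axis i 1) x"
    unfolding D_remove[of c _ x i] by (simp add: axis_def)
  ultimately show ?thesis by (simp only:)
qed

lemma partial_deriv_D:
  fixes n :: "nat ^ 'N::finite"
  assumes "c > 0"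
  shows "partial_deriv i (\<lambda>x. a * D c n x) =
           (\<lambda>x. a * of_real (real (n $ i) / c) * D c (n - axis i 1) x)"
  unfolding partial_deriv_def mult.assoc
  by (intro ext vector_derivative_at has_vector_derivative_mult_right has_vector_derivative_D assms)

lemma partial_deriv_D_diff:
  fixes n m :: "nat ^ 'N::finite"
  assumes "c > 0"
  shows "partial_deriv i (\<lambda>x. a * D c n x - b * D c m x) x =
           a * (of_real (real (n $ i) / c) * D c (n - axis i 1) x)
         - b * (of_real (real (m $ i) / c) * D c (m - axis i 1) x)"
  unfolding partial_deriv_def
  by (intro vector_derivative_at has_vector_derivative_diff has_vector_derivative_mult_right
      has_vector_derivative_D assms)

text \<open>\<open>C_k\<close> asks for total differentiability, which the partial derivatives alone
  do not give.\<close>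

lemma differentiable_D:
  fixes n :: "nat ^ 'N::finite"
  assumes "c > 0"
  shows "(\<lambda>x. a * D c n x) differentiable at x"
proof -
  have "((\<lambda>x. H (n $ j) (x $ j) c) has_derivative
      (\<lambda>h. real (n $ j) / c * H (n $ j - 1) (x $ j) c * (h $ j))) (at x)" for j
    using has_derivative_compose[OF bounded_linear_imp_has_derivative[OF bounded_linear_vec_nth]
      DERIV_H[OF assms, unfolded has_field_derivative_def]] .
  then have "((\<lambda>x. \<Prod>j\<in>UNIV. H (n $ j) (x $ j) c) has_derivative
      (\<lambda>h. \<Sum>j\<in>UNIV. real (n $ j) / c * H (n $ j - 1) (x $ j) c * (h $ j) *
        (\<Prod>k\<in>UNIV - {j}. H (n $ k) (x $ k) c))) (at x)"
    by (intro has_derivative_prod)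
  then have "(\<lambda>x. a * complex_of_real (\<Prod>j\<in>UNIV. H (n $ j) (x $ j) c)) differentiable at x"
    by (intro differentiable_mult differentiable_const differentiableI[OF has_derivative_of_real])
  then show ?thesis by (simp add: D_def)
qed

lemma C_k_D:
  fixes n :: "nat ^ 'N::finite"
  assumes "c > 0"
  shows "C_k k (\<lambda>x. a * D c n x)"
\<comment> \<open>Partial derivatives of multiples of \<open>D c n\<close> are multiples of
  \<open>D\<close> at a lowered index, hence the generalisation over \<open>a\<close> and
  \<open>n\<close>.\<close>
proof (induction k arbitrary: a n)
  case 0
  show ?case
    by (simp only: C_k.simps) (intro continuous_at_imp_continuous_on ballI
        differentiable_imp_continuous_within differentiable_D assms)
next
  case (Suc k)
  then show ?case
    unfolding C_k.simps partial_deriv_D[OF assms] using differentiable_D[OF assms] by blast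
qed

text \<open>Hops and derivatives at \<open>i\<close> and \<open>j\<close> leave the factors at all
  other sites unchanged; their product \<open>?R\<close> factors out and
  \<open>H_pair_duality\<close> applies.\<close>

lemma D_pair_term:
  fixes n :: "nat ^ 'N::finite"
  assumes "c > 0" and "i \<noteq> j"
  shows "of_nat (n $ i) * (D c (hop n i j) x - D c n x)
           + of_nat (n $ j) * (D c (hop n j i) x - D c n x)
       = of_real c * deriv_diff i j (deriv_diff i j (D c n)) x
           - of_real (x $ i - x $ j) * deriv_diff i j (D c n) x"
proof -
  let ?R = "\<Prod>k\<in>UNIV - {i} - {j}. H (n $ k) (x $ k) c"
  let ?A = "\<lambda>a. H a (x $ i) c" and ?B = "\<lambda>b. H b (x $ j) c"
  have D_pair: "D c m x = of_real (?R * (?A (m $ i) * ?B (m $ j)))"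
    if "\<And>k. k \<noteq> i \<Longrightarrow> k \<noteq> j \<Longrightarrow> m $ k = n $ k" for m
  proof -
    have "(\<Prod>k\<in>UNIV. H (m $ k) (x $ k) c) =
        ?A (m $ i) * (?B (m $ j) * (\<Prod>k\<in>UNIV - {i} - {j}. H (m $ k) (x $ k) c))"
      using \<open>i \<noteq> j\<close> by (simp add: prod.remove[of UNIV i] prod.remove[of "UNIV - {i}" j])
    also have "(\<Prod>k\<in>UNIV - {i} - {j}. H (m $ k) (x $ k) c) = ?R"
      using that by (intro prod.cong) auto
    finally show ?thesis by (simp add: D_def algebra_simps)
  qed
  have dd: "deriv_diff i j (D c n) = (\<lambda>x. of_real (real (n $ i) / c) * D c (n - axis i 1) x
      - of_real (real (n $ j) / c) * D c (n - axis j 1) x)"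
    using partial_deriv_D[OF \<open>c > 0\<close>, of _ 1 n] by (simp add: deriv_diff_def fun_eq_iff)
  let ?a = "n $ i" and ?b = "n $ j"
  have ij: "i \<noteq> j" "j \<noteq> i" using \<open>i \<noteq> j\<close> by auto
  have comps: "D c n x = of_real (?R * (?A ?a * ?B ?b))"
    "D c (hop n i j) x = of_real (?R * (?A (?a - 1) * ?B (?b + 1)))"
    "D c (hop n j i) x = of_real (?R * (?A (?a + 1) * ?B (?b - 1)))"
    "D c (n - axis i 1) x = of_real (?R * (?A (?a - 1) * ?B ?b))"
    "D c (n - axis j 1) x = of_real (?R * (?A ?a * ?B (?b - 1)))"
    "D c (n - axis i 1 - axis i 1) x = of_real (?R * (?A (?a - 2) * ?B ?b))"
    "D c (n - axis j 1 - axis j 1) x = of_real (?R * (?A ?a * ?B (?b - 2)))"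
    "D c (n - axis i 1 - axis j 1) x = of_real (?R * (?A (?a - 1) * ?B (?b - 1)))"
    "D c (n - axis j 1 - axis i 1) x = of_real (?R * (?A (?a - 1) * ?B (?b - 1)))"
    using ij by (subst D_pair; simp add: hop_def axis_def numeral_2_eq_2)+
  have idx: "(n - axis i 1) $ i = ?a - 1" "(n - axis i 1) $ j = ?b"
    "(n - axis j 1) $ i = ?a" "(n - axis j 1) $ j = ?b - 1"
    using ij by (simp_all add: axis_def)
  \<comment> \<open>Everything is the image of a real number, so this is a real polynomial identity.
    \<open>P\<close>, \<open>P1\<close>, \<open>P2\<close> stand for the factor at \<open>i\<close>
    with index lowered by 0, 1, 2; \<open>Q\<close>, \<open>Q1\<close>, \<open>Q2\<close> do so at
    \<open>j\<close>.\<close>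
  have ring: "of_real c * (of_real u * (of_real u' * of_real (R * (P2 * Q)))
          - of_real v * (of_real u * of_real (R * (P1 * Q1)))
          - (of_real u * (of_real v * of_real (R * (P1 * Q1)))
          - of_real v * (of_real v' * of_real (R * (P * Q2)))))
        - of_real z * (of_real u * of_real (R * (P1 * Q)) - of_real v * of_real (R * (P * Q1))) =
      complex_of_real (R * (c * (u * (u' * P2) * Q - 2 * (u * P1 * (v * Q1)) + P * (v * (v' * Q2)))
        - z * (u * P1 * Q - P * (v * Q1))))"
    for c u u' v v' z R P P1 P2 Q Q1 Q2 :: real
    unfolding of_real_mult[symmetric] of_real_diff[symmetric] of_real_eq_iff by algebra
  have "of_real c * deriv_diff i j (deriv_diff i j (D c n)) x
           - of_real (x $ i - x $ j) * deriv_diff i j (D c n) x =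
      of_real (?R * (c * (real ?a / c * (real (?a - 1) / c * ?A (?a - 2)) * ?B ?b
           - 2 * (real ?a / c * ?A (?a - 1) * (real ?b / c * ?B (?b - 1)))
           + ?A ?a * (real ?b / c * (real (?b - 1) / c * ?B (?b - 2))))
         - (x $ i - x $ j) * (real ?a / c * ?A (?a - 1) * ?B ?b - ?A ?a * (real ?b / c * ?B (?b - 1)))))"
    unfolding dd unfolding deriv_diff_def partial_deriv_D_diff[OF \<open>c > 0\<close>] idx comps
    by (rule ring)
  also have "\<dots> = of_real (?R * (real ?a * (?A (?a - 1) * ?B (?b + 1) - ?A ?a * ?B ?b)
         + real ?b * (?A (?a + 1) * ?B (?b - 1) - ?A ?a * ?B ?b)))"
    unfolding H_pair_duality[OF \<open>c > 0\<close>] ..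
  also have "\<dots> = of_nat ?a * (D c (hop n i j) x - D c n x)
           + of_nat ?b * (D c (hop n j i) x - D c n x)"
    unfolding comps by (simp add: algebra_simps)
  finally show ?thesis ..
qed

theorem theorem3p10:
  fixes c :: real
  assumes "c > 0"
  shows "(\<forall>n :: nat ^ 'N::{finite,linorder}. smooth (D c n)) \<and>
         in_duality (L_IRW :: (nat ^ 'N::{finite,linorder} \<Rightarrow> complex) \<Rightarrow> _) (L_DIF c) (D c)"
proof (intro conjI allI)
  fix n :: "nat ^ 'N::{finite,linorder}"
  show "smooth (D c n)"
    using C_k_D[OF assms, of _ 1 n] by (simp add: smooth_def)
next
  show "in_duality (L_IRW :: (nat ^ 'N::{finite,linorder} \<Rightarrow> complex) \<Rightarrow> _) (L_DIF c) (D c)"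
    unfolding in_duality_def L_IRW_def L_DIF_def
    \<comment> \<open>Deleting \<open>of_real_diff\<close> keeps \<open>x $ i - x $ j\<close> in the
      form that \<open>D_pair_term\<close> expects.\<close>
    by (intro allI sum.cong refl) (auto simp del: of_real_diff intro!: D_pair_term assms)
qed

end
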